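(* For every digraph $\vec{H}$, the class of $\vec{H}$-free digraphs has unbounded cop number; that is, there is no constant $C$ such that $c(\vec{D})\le C$ for every $\vec{H}$-free digraph $\vec{D}$.
   Context: A digraph is a finite directed graph with no loops and no parallel arcs (two arcs with the same tail and the same head), which is weakly connected (its underlying undirected graph is connected). A pair of opposite arcs $uv$ and $vu$ is allowed. Game of cops and robbers on a digraph $\vec{D}$: the cop player has $k\ge 1$ pieces (cops) and the robber has one piece. First the cop player places the $k$ cops on (not necessarily distinct) vertices, then the robber chooses a vertex. In each round, first each cop either stays or moves along an arc from its current vertex (tail) to the head of that arc; then the robber either stays or moves along an arc from tail to head. The cops win if at some point some cop is on the same vertex as the robber; the robber wins if he is never caught. Both players have complete information. The cop number $c(\vec{D})$ is the minimum $k$ such that $k$ cops have a winning strategy. A digraph is $\vec{H}$-free if it contains no induced subdigraph isomorphic to $\vec{H}$. A class of digraphs has bounded cop number if there is a constant $C$ such that every digraph in the class has cop number at most $C$; otherwise the class has unbounded cop number.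
   Formalization: The digraph H is required to have at least two vertices; for the one-vertex digraph the claim fails, since every digraph contains it as an induced subdigraph, so the class of H-free digraphs is empty and trivially has bounded cop number. *)

theory Defs
  imports "Graph_Theory.Graph_Theory"
begin

section \<open>Digraphs and induced subdigraphs\<close>

text \<open>The locale \<^locale>\<open>digraph\<close> is: finite, no loops, no parallel arcs (opposite arcs are allowed).
  The predicate \<^const>\<open>connected\<close> from the graph library is weak connectedness, and it includes
  nonemptiness of the vertex set.\<close>

definition conn_digraph :: "('a, 'b) pre_digraph \<Rightarrow> bool" where
  "conn_digraph D \<longleftrightarrow> digraph D \<and> connected D"

definition induced_free :: "('a, 'b) pre_digraph \<Rightarrow> ('v, 'e) pre_digraph \<Rightarrow> bool" where
  "induced_free H D \<longleftrightarrow> \<not> (\<exists>S. induced_subgraph S D \<and> digraph_iso H S)"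

text \<open>Every finite digraph is isomorphic to one with vertices in \<^typ>\<open>nat\<close> and arcs in
  \<^typ>\<open>nat \<times> nat\<close>, so these types suffice to range over all digraphs up to isomorphism.\<close>

definition free_class :: "('a, 'b) pre_digraph \<Rightarrow> (nat, nat \<times> nat) pre_digraph set" where
  "free_class H = {D. conn_digraph D \<and> induced_free H D}"


section \<open>Cops and robbers\<close>

definition game_move :: "('v, 'e) pre_digraph \<Rightarrow> 'v \<Rightarrow> 'v \<Rightarrow> bool" where
  "game_move D u v \<longleftrightarrow> u \<in> verts D \<and> (v = u \<or> u \<rightarrow>\<^bsub>D\<^esub> v)"

text \<open>\<open>r 0\<close> is the vertex chosen by the robber at the start, \<open>r n\<close> his vertex after round \<open>n\<close>.
  Since staying is always allowed, every finite play extends to an infinite one.\<close>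

definition robber_play :: "('v, 'e) pre_digraph \<Rightarrow> (nat \<Rightarrow> 'v) \<Rightarrow> bool" where
  "robber_play D r \<longleftrightarrow> r 0 \<in> verts D \<and> (\<forall>n. game_move D (r n) (r (Suc n)))"

text \<open>A strategy for cops \<open>0, \<dots>, k - 1\<close> maps the list of robber positions seen so far to the
  positions of the cops; the cops' own earlier positions are determined by the prefixes of that list.
  The value at \<open>[]\<close> is the initial placement, and the value at \<open>[r 0, \<dots>, r n]\<close> gives the positions
  after the cops' move in round \<open>n + 1\<close>. Moves after a capture are irrelevant (cops may stay).\<close>

definition cop_strategy ::
    "('v, 'e) pre_digraph \<Rightarrow> nat \<Rightarrow> ('v list \<Rightarrow> nat \<Rightarrow> 'v) \<Rightarrow> bool" where
  "cop_strategy D k \<sigma> \<longleftrightarrow>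
     (\<forall>i<k. \<sigma> [] i \<in> verts D) \<and>
     (\<forall>r n. robber_play D r \<longrightarrow>
        (\<forall>i<k. game_move D (\<sigma> (map r [0..<n]) i) (\<sigma> (map r [0..<Suc n]) i)))"

text \<open>The two disjuncts are capture upon the robber's arrival at \<open>r n\<close> (his initial choice or his
  move in round \<open>n\<close>) and capture by the cops' move in round \<open>n + 1\<close>.\<close>

definition winning_cop_strategy ::
    "('v, 'e) pre_digraph \<Rightarrow> nat \<Rightarrow> ('v list \<Rightarrow> nat \<Rightarrow> 'v) \<Rightarrow> bool" where
  "winning_cop_strategy D k \<sigma> \<longleftrightarrow>
     cop_strategy D k \<sigma> \<and>
     (\<forall>r. robber_play D r \<longrightarrow>
        (\<exists>n. \<exists>i<k. \<sigma> (map r [0..<n]) i = r n \<or> \<sigma> (map r [0..<Suc n]) i = r n))"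

definition cops_win :: "('v, 'e) pre_digraph \<Rightarrow> nat \<Rightarrow> bool" where
  "cops_win D k \<longleftrightarrow> (\<exists>\<sigma>. winning_cop_strategy D k \<sigma>)"

definition cop_number :: "('v, 'e) pre_digraph \<Rightarrow> nat" where
  "cop_number D = (LEAST k. 1 \<le> k \<and> cops_win D k)"

definition bounded_cop_number :: "('v, 'e) pre_digraph set \<Rightarrow> bool" where
  "bounded_cop_number \<D> \<longleftrightarrow> (\<exists>C. \<forall>D\<in>\<D>. cop_number D \<le> C)"


section \<open>Sanity checks\<close>

text \<open>The minimum defining the cop number is attained: occupying every vertex wins.\<close>

lemma cops_win_card_verts:
  assumes "finite (verts D)"
  shows "cops_win D (card (verts D))"
proof -
  obtain f where f: "bij_betw f {0..<card (verts D)} (verts D)"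
    using ex_bij_betw_nat_finite[OF assms] by blast
  have "winning_cop_strategy D (card (verts D)) (\<lambda>_. f)"
    unfolding winning_cop_strategy_def cop_strategy_def game_move_def
  proof (intro conjI allI impI)
    fix r :: "nat \<Rightarrow> 'a" assume "robber_play D r"
    then have "r 0 \<in> f ` {0..<card (verts D)}"
      using f by (simp add: robber_play_def bij_betw_def)
    then obtain i where "i < card (verts D)" "f i = r 0" by auto
    then show "\<exists>n. \<exists>i<card (verts D). f i = r n \<or> f i = r n" by blast
  qed (use f in \<open>auto simp: bij_betw_def\<close>)
  then show ?thesis by (auto simp: cops_win_def)
qed

lemma cop_number_attained:
  assumes "conn_digraph D"
  shows "1 \<le> cop_number D \<and> cops_win D (cop_number D)"
proof -
  interpret digraph D using assms by (simp add: conn_digraph_def)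
  have "verts D \<noteq> {}"
    using assms by (simp add: conn_digraph_def connected_def strongly_connected_def)
  then have "1 \<le> card (verts D) \<and> cops_win D (card (verts D))"
    using cops_win_card_verts[of D] by (simp add: Suc_le_eq card_gt_0_iff)
  then show ?thesis unfolding cop_number_def by (rule LeastI)
qed

text \<open>The one-vertex digraph is an induced subdigraph of every digraph, so its class is empty.\<close>

lemma free_class_one_vertex:
  assumes "conn_digraph H" "card (verts H) = 1"
  shows "free_class H = {}" "bounded_cop_number (free_class H)"
proof -
  interpret H: digraph H using assms(1) by (simp add: conn_digraph_def)
  obtain h where h: "verts H = {h}" using assms(2) by (auto simp: card_1_singleton_iff)
  have arcs: "arcs H = {}"
    using H.no_loops H.tail_in_verts H.head_in_verts h by fastforce
  have "\<not> induced_free H D" if D: "conn_digraph D" for D :: "(nat, nat \<times> nat) pre_digraph"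
  proof -
    interpret D: digraph D using D by (simp add: conn_digraph_def)
    obtain v where v: "v \<in> verts D"
      using D by (auto simp: conn_digraph_def connected_def strongly_connected_def)
    let ?f = "\<lparr>iso_verts = \<lambda>_. v, iso_arcs = \<lambda>_. undefined,
      iso_head = head D, iso_tail = tail D\<rparr>"
    have "{e \<in> arcs D. tail D e = v \<and> head D e = v} = {}"
      using D.no_loops by fastforce
    then have "D \<restriction> {v} = app_iso ?f H"
      by (simp add: induce_subgraph_def app_iso_def h arcs)
    moreover have "H.digraph_isomorphism ?f"
      by (simp add: H.digraph_isomorphism_def h arcs H.wf_digraph_axioms)
    ultimately have "digraph_iso H (D \<restriction> {v})" by (auto simp: digraph_iso_def)
    moreover have "induced_subgraph (D \<restriction> {v}) D" using v by (intro D.induced_induce) simp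
    ultimately show ?thesis by (auto simp: induced_free_def)
  qed
  then show "free_class H = {}" by (auto simp: free_class_def)
  then show "bounded_cop_number (free_class H)" by (simp add: bounded_cop_number_def)
qed

end

theory Submission
  imports Defs
begin

text \<open>
  Whether \<open>H\<close> is symmetric (every arc comes together with its reverse) decides which family of
  \<open>H\<close>-free digraphs defeats many cops, because symmetry is inherited by induced subdigraphs.

  If \<open>H\<close> is not symmetric, every symmetric digraph is \<open>H\<close>-free, so undirected graphs are at the
  robber's disposal. In the hypercube of dimension \<open>2 * C + 1\<close> a cop who is not on the robber's
  vertex guards at most two of the neighbours of that vertex (\<open>flips_guarded_by_one_cop\<close>), so \<open>C\<close>
  cops always leave a neighbour to which the robber can escape.

  If \<open>H\<close> is symmetric, it contains a pair of opposite arcs, since it is connected and has at least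
  two vertices. Hence every digraph without such a pair is \<open>H\<close>-free. Connectedness is only required
  in the weak sense, so a star with all arcs directed towards its centre is allowed. Nobody can move
  to a leaf of it, and the robber stays forever on a leaf on which no cop was placed.

  In both cases the robber survives by staying in a region in which, from each vertex that is not
  occupied by a cop, he can reach a vertex that no cop attacks; \<open>cop_number_greater\<close> turns this local
  condition into a lower bound on the cop number.
\<close>

section \<open>A local condition for the robber to escape\<close>

text \<open>
  The invariant is that when the cops are to move, none of them can reach the robber; so the vertex
  of the robber is free when his own turn comes, and the local condition restores the invariant. The
  initial choice is reduced to the same situation: the robber picks a free vertex \<open>v0\<close> of \<open>R\<close> after
  the placement of the cops, and starts on the vertex to which he would move from \<open>v0\<close>.
\<close>
lemma robber_escapes:
  assumes fin: "finite R" and sub: "R \<subseteq> verts D" and large: "k < card R"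
    and safe: "\<And>P v. finite P \<Longrightarrow> card P \<le> k \<Longrightarrow> v \<in> R \<Longrightarrow> v \<notin> P \<Longrightarrow>
      \<exists>w\<in>R. game_move D v w \<and> (\<forall>p\<in>P. \<not> game_move D p w)"
  shows "\<not> cops_win D k"
proof
  assume "cops_win D k"
  then obtain \<sigma> where strat: "cop_strategy D k \<sigma>"
    and win: "\<And>r. robber_play D r \<Longrightarrow>
      \<exists>n. \<exists>i<k. \<sigma> (map r [0..<n]) i = r n \<or> \<sigma> (map r [0..<Suc n]) i = r n"
    by (auto simp: cops_win_def winning_cop_strategy_def)
  define P where "P xs = \<sigma> xs ` {..<k}" for xs
  have P: "finite (P xs)" "card (P xs) \<le> k" for xs
    using card_image_le[of "{..<k}" "\<sigma> xs"] by (auto simp: P_def)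
  have "\<not> R \<subseteq> P []"
    using card_mono[OF P(1), of R "[]"] P(2)[of "[]"] large by linarith
  then obtain v0 where v0: "v0 \<in> R" "v0 \<notin> P []" by blast
  \<comment> \<open>Staying when caught makes the response total, so that the robber's moves are legal before
    anything is known about the cops; the cops are only bound to legal moves against legal play.\<close>
  have "\<exists>w. w \<in> R \<and> game_move D v w \<and> (v \<notin> P xs \<longrightarrow> (\<forall>p\<in>P xs. \<not> game_move D p w))"
    if "v \<in> R" for v xs
  proof (cases "v \<in> P xs")
    case True
    then show ?thesis using that sub by (auto simp: game_move_def)
  next
    case False
    then show ?thesis using safe[OF P(1) P(2) that] by blast
  qed
  then obtain f where f: "\<And>v xs. v \<in> R \<Longrightarrow> f v xs \<in> R \<and> game_move D v (f v xs) \<and>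
      (v \<notin> P xs \<longrightarrow> (\<forall>p\<in>P xs. \<not> game_move D p (f v xs)))"
    by metis
  define h where "h = rec_nat [] (\<lambda>_ xs. xs @ [f (if xs = [] then v0 else last xs) xs])"
  define r where "r n = last (h (Suc n))" for n
  have h_Suc: "h (Suc n) = h n @ [r n]" for n by (simp add: r_def h_def)
  have h_eq: "h n = map r [0..<n]" for n
  proof (induction n)
    case 0
    show ?case by (simp add: h_def)
  next
    case (Suc n)
    then show ?case using h_Suc by simp
  qed
  have r_0: "r 0 = f v0 []" by (simp add: r_def h_def)
  have r_Suc: "r (Suc n) = f (r n) (h (Suc n))" for n
  proof -
    have "h (Suc (Suc n)) = h (Suc n) @ [f (last (h (Suc n))) (h (Suc n))]"
      using h_Suc[of n] by (simp add: h_def)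
    then show ?thesis by (simp add: r_def)
  qed
  have r_R: "r n \<in> R" for n
    by (induction n) (use f v0 in \<open>auto simp: r_0 r_Suc\<close>)
  have play: "robber_play D r"
    unfolding robber_play_def using r_R sub f by (auto simp: r_Suc)
  have cop_move: "game_move D (\<sigma> (h n) i) (\<sigma> (h (Suc n)) i)" if "i < k" for n i
    using strat play that unfolding cop_strategy_def h_eq by blast
  have free: "r n \<notin> P (h (Suc n))" if "\<forall>p\<in>P (h n). \<not> game_move D p (r n)" for n
    using that cop_move[of _ n] by (fastforce simp: P_def)
  have unattacked: "\<forall>p\<in>P (h n). \<not> game_move D p (r n)" for n
  proof (induction n)
    case 0
    have "h 0 = []" by (simp add: h_def)
    then show ?case using f[OF v0(1), of "[]"] v0(2) by (simp add: r_0)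
  next
    case (Suc n)
    then show ?case using f[OF r_R, of n "h (Suc n)"] free[of n] by (simp add: r_Suc)
  qed
  obtain n i where i: "i < k" and "\<sigma> (h n) i = r n \<or> \<sigma> (h (Suc n)) i = r n"
    using win[OF play] unfolding h_eq by blast
  then show False
  proof (elim disjE)
    assume "\<sigma> (h n) i = r n"
    moreover have "\<not> game_move D (\<sigma> (h n) i) (r n)" using unattacked[of n] i by (auto simp: P_def)
    ultimately show False using r_R sub by (auto simp: game_move_def)
  next
    assume "\<sigma> (h (Suc n)) i = r n"
    then show False using free[OF unattacked, of n] i by (force simp: P_def)
  qed
qed

lemma cop_number_greater:
  assumes "conn_digraph D" and "finite R" "R \<subseteq> verts D" "C < card R"
    and safe: "\<And>P v. finite P \<Longrightarrow> card P \<le> C \<Longrightarrow> v \<in> R \<Longrightarrow> v \<notin> P \<Longrightarrow>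
      \<exists>w\<in>R. game_move D v w \<and> (\<forall>p\<in>P. \<not> game_move D p w)"
  shows "C < cop_number D"
proof (rule ccontr)
  assume "\<not> C < cop_number D"
  then have "\<not> cops_win D (cop_number D)"
    using assms(2-4) by (intro robber_escapes[of R] safe) auto
  then show False using cop_number_attained[OF assms(1)] by blast
qed

section \<open>Digraphs on the natural numbers and their induced subdigraphs\<close>

definition rel_digraph :: "nat set \<Rightarrow> (nat \<times> nat) set \<Rightarrow> (nat, nat \<times> nat) pre_digraph" where
  "rel_digraph V A = with_proj \<lparr>pverts = V, parcs = A\<rparr>"

lemma rel_digraph_simps [simp]:
  "verts (rel_digraph V A) = V" "arcs_ends (rel_digraph V A) = A"
  by (simp_all add: rel_digraph_def)

text \<open>
  An arc to a smaller vertex at every vertex except \<open>0\<close> gives a path to \<open>0\<close>, and two such paths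
  join any two vertices of the underlying graph.
\<close>
lemma conn_digraph_rel_digraph:
  assumes V: "finite V" "0 \<in> V" and A: "A \<subseteq> V \<times> V" "irrefl A"
    and desc: "\<And>v. v \<in> V \<Longrightarrow> v \<noteq> 0 \<Longrightarrow> \<exists>w<v. (v, w) \<in> A"
  shows "conn_digraph (rel_digraph V A)"
proof -
  have "finite A" using A(1) V(1) by (meson finite_SigmaI finite_subset)
  then interpret D: digraph "rel_digraph V A"
    using V A by unfold_locales (auto simp: rel_digraph_def irrefl_def arc_to_ends_def)
  interpret S: pair_wf_digraph "mk_symmetric (rel_digraph V A)" ..
  have sym: "symmetric (mk_symmetric (rel_digraph V A))" by (rule symmetric_mk_symmetric)
  have step: "v \<rightarrow>\<^bsub>mk_symmetric (rel_digraph V A)\<^esub> w" if "(v, w) \<in> A" for v w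
    using that by (auto simp: parcs_mk_symmetric rel_digraph_def)
  have to_0: "v \<rightarrow>\<^sup>*\<^bsub>mk_symmetric (rel_digraph V A)\<^esub> 0" if "v \<in> V" for v
    using that
  proof (induction v rule: less_induct)
    case (less v)
    show ?case
    proof (cases "v = 0")
      case True
      then show ?thesis using less.prems by (simp add: S.reachable_refl)
    next
      case False
      then obtain w where w: "w < v" "(v, w) \<in> A" using desc less.prems by blast
      then have "w \<rightarrow>\<^sup>*\<^bsub>mk_symmetric (rel_digraph V A)\<^esub> 0" using less.IH A(1) by blast
      with step[OF w(2)] show ?thesis by (rule wf_digraph.adj_reachable_trans[OF S.wf_digraph])
    qed
  qed
  have "connected (rel_digraph V A)"
    unfolding connected_def
  proof (rule strongly_connectedI)
    fix u v assume "u \<in> verts (mk_symmetric (rel_digraph V A))"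
      "v \<in> verts (mk_symmetric (rel_digraph V A))"
    then show "u \<rightarrow>\<^sup>*\<^bsub>mk_symmetric (rel_digraph V A)\<^esub> v"
      using to_0[of u] symmetric_reachable[OF sym to_0[of v]]
      by (simp add: S.reachable_trans[of u 0 v])
  qed (use V in auto)
  then show ?thesis by (simp add: conn_digraph_def D.digraph_axioms)
qed

lemma induced_copy_adj:
  assumes "wf_digraph H" "induced_subgraph S D" "digraph_iso H S"
  obtains f where "\<And>u v. u \<in> verts H \<Longrightarrow> v \<in> verts H \<Longrightarrow> u \<rightarrow>\<^bsub>H\<^esub> v \<longleftrightarrow> f u \<rightarrow>\<^bsub>D\<^esub> f v"
proof -
  interpret H: wf_digraph H by fact
  obtain g where g: "H.digraph_isomorphism g" and S: "S = app_iso g H"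
    using assms(3) by (auto simp: digraph_iso_def)
  have S_D: "arcs_ends S = {(x, y) \<in> arcs_ends D. x \<in> verts S \<and> y \<in> verts S}"
    using assms(2) by (auto simp: induced_subgraph_def subgraph_def compatible_def arcs_ends_conv)
  have "u \<rightarrow>\<^bsub>H\<^esub> v \<longleftrightarrow> iso_verts g u \<rightarrow>\<^bsub>S\<^esub> iso_verts g v"
    if "u \<in> verts H" "v \<in> verts H" for u v
    using that by (auto simp: S H.arcs_ends_app_iso_eq[OF g] H.iso_verts_eq_iff[OF g]
        H.adj_in_verts)
  then have "u \<rightarrow>\<^bsub>H\<^esub> v \<longleftrightarrow> iso_verts g u \<rightarrow>\<^bsub>D\<^esub> iso_verts g v"
    if "u \<in> verts H" "v \<in> verts H" for u v
    using that by (auto simp: S_D) (simp_all add: S)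
  then show ?thesis by (rule that)
qed

lemma symmetric_induced_free:
  assumes "wf_digraph H" "\<not> symmetric H" "symmetric D"
  shows "induced_free H D"
  unfolding induced_free_def
proof
  assume "\<exists>S. induced_subgraph S D \<and> digraph_iso H S"
  then obtain f where f: "\<And>u v. u \<in> verts H \<Longrightarrow> v \<in> verts H \<Longrightarrow> u \<rightarrow>\<^bsub>H\<^esub> v \<longleftrightarrow> f u \<rightarrow>\<^bsub>D\<^esub> f v"
    using induced_copy_adj[OF assms(1)] by metis
  obtain u v where "u \<rightarrow>\<^bsub>H\<^esub> v" "\<not> v \<rightarrow>\<^bsub>H\<^esub> u"
    using assms(2) by (auto simp: symmetric_def sym_def)
  then show False
    using f assms(3) wf_digraph.adj_in_verts[OF assms(1)] by (metis arcs_ends_symmetric)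
qed

lemma asym_induced_free:
  assumes "wf_digraph H" "symmetric H" "arcs H \<noteq> {}" "asym (arcs_ends D)"
  shows "induced_free H D"
  unfolding induced_free_def
proof
  assume "\<exists>S. induced_subgraph S D \<and> digraph_iso H S"
  then obtain f where f: "\<And>u v. u \<in> verts H \<Longrightarrow> v \<in> verts H \<Longrightarrow> u \<rightarrow>\<^bsub>H\<^esub> v \<longleftrightarrow> f u \<rightarrow>\<^bsub>D\<^esub> f v"
    using induced_copy_adj[OF assms(1)] by metis
  obtain u v where uv: "u \<rightarrow>\<^bsub>H\<^esub> v"
    using assms(3) by (auto simp: arcs_ends_conv)
  then have "v \<rightarrow>\<^bsub>H\<^esub> u" using assms(2) arcs_ends_symmetric by metis
  with uv show False
    using f assms(4) wf_digraph.adj_in_verts[OF assms(1)] by (meson asymD)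
qed

lemma conn_digraph_arcs_nonempty:
  assumes "conn_digraph H" "2 \<le> card (verts H)"
  shows "arcs H \<noteq> {}"
proof
  assume empty: "arcs H = {}"
  have "finite (verts H)" by (rule card_ge_0_finite) (use assms(2) in linarith)
  moreover have "\<not> card (verts H) \<le> Suc 0" using assms(2) by linarith
  ultimately obtain u v where uv: "u \<in> verts H" "v \<in> verts H" "u \<noteq> v"
    using card_le_Suc0_iff_eq[of "verts H"] by blast
  then have "(u, v) \<in> rtrancl_on (verts H) ((arcs_ends H)\<^sup>s)"
    using assms(1) by (auto simp: conn_digraph_def connected_conv)
  then show False
    using empty uv by (cases rule: rtrancl_on.cases) (auto simp: arcs_ends_conv symcl_def)
qed

section \<open>Hypercubes\<close>

text \<open>The vertices are the binary strings of length \<open>d\<close>, read as numbers below \<open>2 ^ d\<close>.\<close>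
definition hypercube :: "nat \<Rightarrow> (nat, nat \<times> nat) pre_digraph" where
  "hypercube d = rel_digraph {..<2 ^ d} {(u, flip_bit i u) |u i. u < 2 ^ d \<and> i < d}"

lemma flip_bit_less_exp:
  fixes u :: nat
  assumes "u < 2 ^ d" "i < d"
  shows "flip_bit i u < 2 ^ d"
  using assms take_bit_flip_bit_eq[of d i u] by (simp flip: take_bit_nat_eq_self_iff)

lemma flip_bit_flip_bit [simp]: "flip_bit i (flip_bit i u) = (u :: nat)"
  by (auto simp: bit_eq_iff bit_simps)

lemma flip_bit_neq [simp]: "flip_bit i u \<noteq> (u :: nat)"
  by (auto simp: bit_eq_iff bit_simps)

lemma hypercube_simps:
  "verts (hypercube d) = {..<2 ^ d}"
  "u \<rightarrow>\<^bsub>hypercube d\<^esub> v \<longleftrightarrow> u < 2 ^ d \<and> (\<exists>i<d. v = flip_bit i u)"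
  by (auto simp: hypercube_def)

lemma symmetric_hypercube: "symmetric (hypercube d)"
  unfolding symmetric_def
proof (rule symI)
  fix u v assume "u \<rightarrow>\<^bsub>hypercube d\<^esub> v"
  then obtain i where i: "u < 2 ^ d" "i < d" "v = flip_bit i u"
    unfolding hypercube_simps by blast
  then have "v < 2 ^ d" "u = flip_bit i v" using flip_bit_less_exp by simp_all
  with i(2) show "v \<rightarrow>\<^bsub>hypercube d\<^esub> u" unfolding hypercube_simps by blast
qed

lemma conn_digraph_hypercube: "conn_digraph (hypercube d)"
  unfolding hypercube_def
proof (rule conn_digraph_rel_digraph)
  fix v :: nat assume v: "v \<in> {..<2 ^ d}" "v \<noteq> 0"
  \<comment> \<open>Erasing any 1 in the binary expansion of \<open>v\<close> yields a smaller neighbour.\<close>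
  then obtain i where i: "bit v i" by (auto simp: bit_eq_iff)
  have "take_bit d v = v" using v(1) by (simp add: take_bit_nat_eq_self_iff)
  then have "i < d" using i bit_take_bit_iff[of d v i] by simp
  moreover have "flip_bit i v < v"
  proof -
    have "v = set_bit i (flip_bit i v)"
      using i by (intro bit_eqI) (auto simp: bit_simps)
    also have "\<dots> = flip_bit i v + 2 ^ i"
      using i by (simp add: set_bit_eq bit_simps)
    finally have "v = flip_bit i v + 2 ^ i" .
    moreover have "(0 :: nat) < 2 ^ i" by simp
    ultimately show ?thesis by linarith
  qed
  ultimately show "\<exists>w<v. (v, w) \<in> {(u, flip_bit i u) |u i. u < 2 ^ d \<and> i < d}"
    using v by auto
next
  show "{(u :: nat, flip_bit i u) |u i. u < 2 ^ d \<and> i < d} \<subseteq> {..<2 ^ d} \<times> {..<2 ^ d}"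
    using flip_bit_less_exp by blast
  show "irrefl {(u :: nat, flip_bit i u) |u i. u < 2 ^ d \<and> i < d}"
  proof (rule irreflI, rule notI)
    fix a :: nat assume "(a, a) \<in> {(u, flip_bit i u) |u i. u < 2 ^ d \<and> i < d}"
    then obtain i where "a = flip_bit i a" by blast
    then show False using flip_bit_neq[of i a] by simp
  qed
qed simp_all

text \<open>
  Let \<open>j\<close> be a bit at which \<open>p\<close> and \<open>v\<close> differ. If bit \<open>i \<noteq> j\<close> of \<open>v\<close> is flipped, the result still
  differs from \<open>p\<close> at \<open>j\<close>, hence can be adjacent to \<open>p\<close> only if \<open>j\<close> and \<open>i\<close> are the two bits in which
  \<open>v\<close> and \<open>p\<close> differ. So besides \<open>j\<close> at most one index is possible.
\<close>
lemma flips_guarded_by_one_cop: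
  assumes "p \<noteq> v"
  shows "card {i. i < d \<and> game_move (hypercube d) p (flip_bit i v)} \<le> 2"
proof -
  obtain j where j: "bit p j \<noteq> bit v j" using assms by (auto simp: bit_eq_iff)
  have bits: "bit p l = bit v l \<longleftrightarrow> l \<noteq> i" 
    if "game_move (hypercube d) p (flip_bit i v)" "i \<noteq> j" "l \<noteq> j" for i l
  proof -
    have "flip_bit i v = p \<or> (\<exists>m. flip_bit i v = flip_bit m p)"
      using that(1) by (auto simp: game_move_def hypercube_simps)
    then show ?thesis
    proof
      assume "flip_bit i v = p"
      then show ?thesis using j that(2) by (auto simp: bit_simps)
    next
      assume "\<exists>m. flip_bit i v = flip_bit m p"
      then obtain m where m: "\<And>l. bit (flip_bit i v) l = bit (flip_bit m p) l" by auto
      have "m = j" using m[of j] j that(2) by (auto simp: bit_simps)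
      then show ?thesis using m[of l] that(3) by (auto simp: bit_simps)
    qed
  qed
  let ?G = "{i. i < d \<and> game_move (hypercube d) p (flip_bit i v)}"
  have "i = i'" if "i \<in> ?G - {j}" "i' \<in> ?G - {j}" for i i'
    using bits[of i i] bits[of i' i] that by auto
  then have "card (?G - {j}) \<le> 1" by (auto simp: card_le_Suc0_iff_eq)
  moreover have "card ?G \<le> Suc (card (?G - {j}))"
    using diff_card_le_card_Diff[of "{j}" ?G] by simp
  ultimately show ?thesis by linarith
qed

lemma cop_number_hypercube: "C < cop_number (hypercube (2 * C + 1))"
proof (rule cop_number_greater[where R = "{..<2 ^ (2 * C + 1)}"])
  have "C < 2 ^ C" by (rule less_exp)
  also have "\<dots> \<le> 2 ^ (2 * C + 1)" by (rule power_increasing) auto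
  finally show "C < card {..<2 ^ (2 * C + 1) :: nat}" by simp
next
  fix P :: "nat set" and v :: nat
  assume P: "finite P" "card P \<le> C" and v: "v \<in> {..<2 ^ (2 * C + 1)}" "v \<notin> P"
  define G where "G p = {i. i < 2 * C + 1 \<and> game_move (hypercube (2 * C + 1)) p (flip_bit i v)}" for p
  have "card (\<Union>p\<in>P. G p) \<le> (\<Sum>p\<in>P. card (G p))" using P(1) by (rule card_UN_le)
  also have "\<dots> \<le> (\<Sum>p\<in>P. 2)"
    unfolding G_def by (rule sum_mono, rule flips_guarded_by_one_cop) (use v(2) in blast)
  finally have "card (\<Union>p\<in>P. G p) < card {..<2 * C + 1}" using P(2) by simp
  moreover have "finite (\<Union>p\<in>P. G p)" using P(1) by (simp add: G_def)
  ultimately have "\<not> {..<2 * C + 1} \<subseteq> (\<Union>p\<in>P. G p)" by (meson card_mono leD)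
  then obtain i where i: "i < 2 * C + 1" "\<forall>p\<in>P. \<not> game_move (hypercube (2 * C + 1)) p (flip_bit i v)"
    by (auto simp: G_def)
  show "\<exists>w\<in>{..<2 ^ (2 * C + 1)}. game_move (hypercube (2 * C + 1)) v w \<and>
      (\<forall>p\<in>P. \<not> game_move (hypercube (2 * C + 1)) p w)"
  proof (rule bexI[of _ "flip_bit i v"])
    have "game_move (hypercube (2 * C + 1)) v (flip_bit i v)"
      using v(1) i(1) unfolding game_move_def hypercube_simps by auto
    then show "game_move (hypercube (2 * C + 1)) v (flip_bit i v) \<and>
      (\<forall>p\<in>P. \<not> game_move (hypercube (2 * C + 1)) p (flip_bit i v))" using i(2) by blast
    show "flip_bit i v \<in> {..<2 ^ (2 * C + 1)}"
      using flip_bit_less_exp[OF _ i(1), of v] v(1) unfolding lessThan_iff by blast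
  qed
next
  show "conn_digraph (hypercube (2 * C + 1))" by (rule conn_digraph_hypercube)
  show "{..<2 ^ (2 * C + 1)} \<subseteq> verts (hypercube (2 * C + 1))"
    unfolding hypercube_simps by (rule order_refl)
qed (rule finite_lessThan)

section \<open>Stars directed towards their centre\<close>

definition in_star :: "nat \<Rightarrow> (nat, nat \<times> nat) pre_digraph" where
  "in_star m = rel_digraph {..m} ({1..m} \<times> {0})"

lemma conn_digraph_in_star: "conn_digraph (in_star m)"
  unfolding in_star_def by (rule conn_digraph_rel_digraph) (auto simp: irrefl_def)

lemma asym_in_star: "asym (arcs_ends (in_star m))"
  by (rule asymI) (simp add: in_star_def)

lemma cop_number_in_star: "C < cop_number (in_star (C + 1))"
proof (rule cop_number_greater[where R = "{1..C + 1}"])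
  fix P and v :: nat
  assume v: "v \<in> {1..C + 1}" "v \<notin> P"
  have "game_move (in_star (C + 1)) v v"
    using v(1) by (simp add: game_move_def in_star_def)
  moreover have "\<not> game_move (in_star (C + 1)) p v" if "p \<in> P" for p
    using v that by (auto simp: game_move_def in_star_def)
  ultimately show "\<exists>w\<in>{1..C + 1}. game_move (in_star (C + 1)) v w \<and>
      (\<forall>p\<in>P. \<not> game_move (in_star (C + 1)) p w)"
    using v(1) by blast
next
  show "{1..C + 1} \<subseteq> verts (in_star (C + 1))" by (auto simp: in_star_def)
qed (simp_all add: conn_digraph_in_star)

section \<open>Unboundedness\<close>

theorem theorem1:
  fixes H :: "('a, 'b) pre_digraph"
  assumes "conn_digraph H"
    and "2 \<le> card (verts H)"
  shows "\<not> bounded_cop_number (free_class H)"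
proof -
  have wf: "wf_digraph H"
    using assms(1) by (auto simp: conn_digraph_def digraph_def fin_digraph_def)
  have "\<exists>D\<in>free_class H. C < cop_number D" for C
  proof (cases "symmetric H")
    case True
    then have "in_star (C + 1) \<in> free_class H"
      using asym_induced_free[OF wf True conn_digraph_arcs_nonempty[OF assms] asym_in_star]
      by (simp add: free_class_def conn_digraph_in_star)
    then show ?thesis using cop_number_in_star by blast
  next
    case False
    then have "hypercube (2 * C + 1) \<in> free_class H"
      using symmetric_induced_free[OF wf False symmetric_hypercube]
      by (simp add: free_class_def conn_digraph_hypercube)
    then show ?thesis using cop_number_hypercube by blast
  qed
  then show ?thesis unfolding bounded_cop_number_def by (meson leD)
qed

end
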